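(* Let $A\in\mathbb{O}^{m\times m}$ and suppose that the characteristic polynomial of the real matrix $\omega(A)$ is $$p(\lambda)=\lambda^t+r_{t-1}\lambda^{t-1}+\cdots+r_1\lambda+r_0 .$$ Then $A$ satisfies the two identities $$A^{(t|}+r_{t-1}A^{(t-1|}+\cdots+r_3A(AA)+r_2A^2+r_1A+r_0I_m=0,$$ $$A^{|t)}+r_{t-1}A^{|t-1)}+\cdots+r_3(AA)A+r_2A^2+r_1A+r_0I_m=0.$$
   Context: $\mathbb{H}$ is the real quaternion algebra with basis $1,i,j,k$, $i^2=j^2=k^2=ijk=-1$, and conjugation $q\mapsto\overline{q}$. The real octonion algebra $\mathbb{O}$ consists of elements $a=a'+a''e$ with $a',a''\in\mathbb{H}$, with componentwise addition and product $(a'+a''e)(b'+b''e)=(a'b'-\overline{b''}a'')+(b''a'+a''\overline{b'})e$. For $q=q_0+q_1i+q_2j+q_3k\in\mathbb{H}$ put $$\phi(q)=\begin{bmatrix} q_0&-q_1&-q_2&-q_3\\ q_1&q_0&-q_3&q_2\\ q_2&q_3&q_0&-q_1\\ q_3&-q_2&q_1&q_0\end{bmatrix},\quad \tau(q)=\begin{bmatrix} q_0&-q_1&-q_2&-q_3\\ q_1&q_0&q_3&-q_2\\ q_2&-q_3&q_0&q_1\\ q_3&q_2&-q_1&q_0\end{bmatrix},$$ $K_4=\mathrm{diag}(1,-1,-1,-1)$, and for $a=a'+a''e\in\mathbb{O}$ $$\omega(a)=\begin{bmatrix}\phi(a') & -\tau(a'')K_4\\ \phi(a'')K_4&\tau(a')\end{bmatrix}\in\mathbb{R}^{8\times8}.$$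 For an octonion matrix $A=(a_{st})\in\mathbb{O}^{m\times n}$, the left adjoint matrix is the block matrix $\omega(A)=[\omega(a_{st})]\in\mathbb{R}^{8m\times 8n}$ (so for $m=n$ the degree $t$ of its characteristic polynomial is $8m$). Matrix products over $\mathbb{O}$ are the usual row-by-column products, which are not associative. For $s\ge1$, $A^{(s|}=A(A(\cdots(AA)\cdots))$ and $A^{|s)}=((\cdots(AA)\cdots)A)A$ with $s$ factors $A$ each; $A^2=AA$. *)

theory Defs
  imports Complex_Main "Jordan_Normal_Form.Char_Poly"
begin

section \<open>Quaternions\<close>

datatype quat = Quat (quat_0: real) (quat_1: real) (quat_2: real) (quat_3: real)

lemma quat_eq_iff:
  "p = q \<longleftrightarrow> quat_0 p = quat_0 q \<and> quat_1 p = quat_1 q \<and> quat_2 p = quat_2 q \<and> quat_3 p = quat_3 q"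
  by (cases p; cases q) simp

instantiation quat :: "{ring_1, real_algebra_1}"
begin

definition "0 = Quat 0 0 0 0"
definition "1 = Quat 1 0 0 0"
definition "p + q = Quat (quat_0 p + quat_0 q) (quat_1 p + quat_1 q) (quat_2 p + quat_2 q) (quat_3 p + quat_3 q)"
definition "p - q = Quat (quat_0 p - quat_0 q) (quat_1 p - quat_1 q) (quat_2 p - quat_2 q) (quat_3 p - quat_3 q)"
definition "- q = Quat (- quat_0 q) (- quat_1 q) (- quat_2 q) (- quat_3 q)"
definition "p * q = Quat
  (quat_0 p * quat_0 q - quat_1 p * quat_1 q - quat_2 p * quat_2 q - quat_3 p * quat_3 q)
  (quat_0 p * quat_1 q + quat_1 p * quat_0 q + quat_2 p * quat_3 q - quat_3 p * quat_2 q)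
  (quat_0 p * quat_2 q - quat_1 p * quat_3 q + quat_2 p * quat_0 q + quat_3 p * quat_1 q)
  (quat_0 p * quat_3 q + quat_1 p * quat_2 q - quat_2 p * quat_1 q + quat_3 p * quat_0 q)"
definition "r *\<^sub>R q = Quat (r * quat_0 q) (r * quat_1 q) (r * quat_2 q) (r * quat_3 q)"

instance
  by standard
    (simp_all add: quat_eq_iff zero_quat_def one_quat_def plus_quat_def minus_quat_def
      uminus_quat_def times_quat_def scaleR_quat_def algebra_simps)

end

definition quat_i :: quat where "quat_i = Quat 0 1 0 0"
definition quat_j :: quat where "quat_j = Quat 0 0 1 0"
definition quat_k :: quat where "quat_k = Quat 0 0 0 1"

lemma quat_basis_relations:
  "quat_i * quat_i = -1" "quat_j * quat_j = -1" "quat_k * quat_k = -1"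
  "quat_i * quat_j * quat_k = -1"
  by (simp_all add: quat_i_def quat_j_def quat_k_def times_quat_def one_quat_def uminus_quat_def)

lemma quat_basis_expansion:
  "q = quat_0 q *\<^sub>R 1 + quat_1 q *\<^sub>R quat_i + quat_2 q *\<^sub>R quat_j + quat_3 q *\<^sub>R quat_k"
  by (simp add: quat_i_def quat_j_def quat_k_def quat_eq_iff one_quat_def plus_quat_def
      scaleR_quat_def)

definition qcnj :: "quat \<Rightarrow> quat" where
  "qcnj q = Quat (quat_0 q) (- quat_1 q) (- quat_2 q) (- quat_3 q)"


section \<open>Octonions\<close>

text \<open>\<open>Oct a' a''\<close> is the octonion \<open>a' + a'' e\<close>.\<close>

datatype octonion = Oct (oct_fst: quat) (oct_snd: quat)

lemma octonion_eq_iff: "a = b \<longleftrightarrow> oct_fst a = oct_fst b \<and> oct_snd a = oct_snd b"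
  by (cases a; cases b) simp

instantiation octonion :: "{real_vector, times, one}"
begin

definition "0 = Oct 0 0"
definition "1 = Oct 1 0"
definition "a + b = Oct (oct_fst a + oct_fst b) (oct_snd a + oct_snd b)"
definition "a - b = Oct (oct_fst a - oct_fst b) (oct_snd a - oct_snd b)"
definition "- a = Oct (- oct_fst a) (- oct_snd a)"
definition "a * b = Oct
  (oct_fst a * oct_fst b - qcnj (oct_snd b) * oct_snd a)
  (oct_snd b * oct_fst a + oct_snd a * qcnj (oct_fst b))"
definition "r *\<^sub>R a = Oct (r *\<^sub>R oct_fst a) (r *\<^sub>R oct_snd a)"

instance
  by standard
    (simp_all add: octonion_eq_iff zero_octonion_def plus_octonion_def minus_octonion_def
      uminus_octonion_def scaleR_octonion_def scaleR_add_left scaleR_add_right)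

end


section \<open>Octonion matrices\<close>

text \<open>
  The product of the matrix library needs entries in a semiring; octonion multiplication is not
  associative, so the product, the real scalar multiples and indexed sums are defined here.
\<close>

definition oct_mat_mult :: "octonion mat \<Rightarrow> octonion mat \<Rightarrow> octonion mat" (infixl "*\<^sub>O" 70) where
  "A *\<^sub>O B = mat (dim_row A) (dim_col B) (\<lambda>(i, j). \<Sum>k<dim_col A. A $$ (i, k) * B $$ (k, j))"

definition oct_mat_scaleR :: "real \<Rightarrow> octonion mat \<Rightarrow> octonion mat" (infixr "\<cdot>\<^sub>O" 75) where
  "r \<cdot>\<^sub>O A = map_mat (\<lambda>a. r *\<^sub>R a) A"

definition oct_mat_sum :: "nat \<Rightarrow> nat \<Rightarrow> (nat \<Rightarrow> octonion mat) \<Rightarrow> nat set \<Rightarrow> octonion mat" where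
  "oct_mat_sum m n F S = mat m n (\<lambda>(i, j). \<Sum>s\<in>S. F s $$ (i, j))"

text \<open>
  \<open>oct_mat_lpow A s\<close> is \<open>A(A(\<cdots>(AA)\<cdots>))\<close> and \<open>oct_mat_rpow A s\<close> is \<open>((\<cdots>(AA)\<cdots>)A)A\<close>, with \<open>s\<close> factors.
  The value at \<open>s = 0\<close> is only a convention.
\<close>

fun oct_mat_lpow :: "octonion mat \<Rightarrow> nat \<Rightarrow> octonion mat" where
  "oct_mat_lpow A 0 = 1\<^sub>m (dim_row A)"
| "oct_mat_lpow A (Suc 0) = A"
| "oct_mat_lpow A (Suc (Suc s)) = A *\<^sub>O oct_mat_lpow A (Suc s)"

fun oct_mat_rpow :: "octonion mat \<Rightarrow> nat \<Rightarrow> octonion mat" where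
  "oct_mat_rpow A 0 = 1\<^sub>m (dim_row A)"
| "oct_mat_rpow A (Suc 0) = A"
| "oct_mat_rpow A (Suc (Suc s)) = oct_mat_rpow A (Suc s) *\<^sub>O A"


section \<open>The left adjoint matrix\<close>

definition phi :: "quat \<Rightarrow> real mat" where
  "phi q = (case q of Quat q0 q1 q2 q3 \<Rightarrow> mat_of_rows_list 4
    [[q0, - q1, - q2, - q3],
     [q1,   q0, - q3,   q2],
     [q2,   q3,   q0, - q1],
     [q3, - q2,   q1,   q0]])"

definition tau :: "quat \<Rightarrow> real mat" where
  "tau q = (case q of Quat q0 q1 q2 q3 \<Rightarrow> mat_of_rows_list 4
    [[q0, - q1, - q2, - q3],
     [q1,   q0,   q3, - q2],
     [q2, - q3,   q0,   q1],
     [q3,   q2, - q1,   q0]])"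

definition K4 :: "real mat" where
  "K4 = mat_diag 4 (\<lambda>i. if i = 0 then 1 else - 1)"

definition omega :: "octonion \<Rightarrow> real mat" where
  "omega a = four_block_mat
     (phi (oct_fst a))      (- (tau (oct_snd a) * K4))
     (phi (oct_snd a) * K4) (tau (oct_fst a))"

text \<open>The block matrix whose \<open>(s, t)\<close> block, of size 8 by 8, is \<open>omega (A $$ (s, t))\<close>.\<close>

definition omega_mat :: "octonion mat \<Rightarrow> real mat" where
  "omega_mat A = mat (8 * dim_row A) (8 * dim_col A)
     (\<lambda>(i, j). omega (A $$ (i div 8, j div 8)) $$ (i mod 8, j mod 8))"

end

theory Submission
  imports Defs
begin

text \<open>
  Octonion multiplication is bilinear, so left multiplication by a fixed octonion \<open>a\<close> is a real
  linear map of an eight-dimensional space, and \<open>omega a\<close> is its matrix (\<open>omega_left_mult\<close>).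
  Consequently \<open>omega_mat A\<close> is the matrix of \<open>X \<mapsto> A *\<^sub>O X\<close> on columns (\<open>omega_mat_mult_col\<close>). The map
  \<open>omega_mat\<close> does not respect products, but a left power \<open>A (A (\<cdots> (A I)))\<close> is obtained by applying
  the single linear map \<open>omega_mat A\<close> repeatedly to the columns of \<open>I\<close>. By the Cayley-Hamilton
  theorem, each orbit of a real matrix satisfies the linear recurrence given by its characteristic
  polynomial (\<open>char_poly_recurrence\<close>). Read back in octonions, this is the first identity.

  For the second identity, conjugation of octonions reverses products. The conjugate transpose
  therefore takes the right powers of \<open>A\<close> to the left powers of its conjugate transpose
  (\<open>oct_adjoint_rpow\<close>). The real representation of the latter is the transpose of \<open>omega_mat A\<close>
  (\<open>omega_mat_adjoint\<close>) and has the same characteristic polynomial, so the second identity is the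
  conjugate transpose of the first one for this other matrix.
\<close>

section \<open>Quaternion multiplication in coordinates\<close>

definition quat_vec :: "quat \<Rightarrow> real vec" where
  "quat_vec q = vec 4 (\<lambda>k. [quat_0 q, quat_1 q, quat_2 q, quat_3 q] ! k)"

lemma quat_vec_carrier [simp]: "quat_vec q \<in> carrier_vec 4"
  by (simp add: quat_vec_def)

lemma less_4: "k < 4 \<longleftrightarrow> k = 0 \<or> k = 1 \<or> k = 2 \<or> k = (3::nat)"
  by auto

lemma sum_4: "(\<Sum>l = 0..<4. f l) = f 0 + f 1 + f 2 + f (3::nat)"
  by (simp add: numeral_eq_Suc)

lemma mat_of_four_rows: "mat_of_rows_list 4 [a, b, c, d] = mat 4 4 (\<lambda>(i, j). [a, b, c, d] ! i ! j)"
  by (rule eq_matI) (simp_all add: mat_of_rows_list_def)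

lemma quat_vec_0: "quat_vec 0 = 0\<^sub>v 4"
  by (rule eq_vecI) (auto simp: less_4 quat_vec_def zero_quat_def)

lemma quat_vec_add: "quat_vec (p + q) = quat_vec p + quat_vec q"
  by (rule eq_vecI) (auto simp: less_4 quat_vec_def plus_quat_def)

lemma quat_vec_uminus: "quat_vec (- q) = - quat_vec q"
  by (rule eq_vecI) (auto simp: less_4 quat_vec_def uminus_quat_def)

lemma quat_vec_scaleR: "quat_vec (c *\<^sub>R q) = c \<cdot>\<^sub>v quat_vec q"
  by (rule eq_vecI) (auto simp: less_4 quat_vec_def scaleR_quat_def)

lemma quat_vec_inject: "quat_vec p = quat_vec q \<Longrightarrow> p = q"
  by (auto simp: quat_eq_iff quat_vec_def vec_eq_iff less_4)

lemma phi_carrier [simp]: "phi q \<in> carrier_mat 4 4"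
  by (cases q) (simp add: phi_def mat_of_four_rows)

lemma tau_carrier [simp]: "tau q \<in> carrier_mat 4 4"
  by (cases q) (simp add: tau_def mat_of_four_rows)

lemma K4_carrier [simp]: "K4 \<in> carrier_mat 4 4"
  by (simp add: K4_def)

lemma phi_K4_carrier [simp]: "phi q * K4 \<in> carrier_mat 4 4"
  by (rule mult_carrier_mat[of _ 4 4]) simp_all

lemma tau_K4_carrier [simp]: "tau q * K4 \<in> carrier_mat 4 4"
  by (rule mult_carrier_mat[of _ 4 4]) simp_all

text \<open>
  With quaternions as column vectors, \<open>phi\<close> represents left multiplication, \<open>tau\<close> right
  multiplication and \<open>K4\<close> conjugation. These three facts turn the block formula for \<open>omega\<close> into
  the product formula of the octonions.
\<close>

lemma phi_left_mult: "phi p *\<^sub>v quat_vec q = quat_vec (p * q)"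
  by (cases p; cases q; rule eq_vecI)
    (auto simp: less_4 phi_def mat_of_four_rows scalar_prod_def sum_4 quat_vec_def times_quat_def)

lemma tau_right_mult: "tau p *\<^sub>v quat_vec q = quat_vec (q * p)"
  by (cases p; cases q; rule eq_vecI)
    (auto simp: less_4 tau_def mat_of_four_rows scalar_prod_def sum_4 quat_vec_def times_quat_def)

lemma K4_qcnj: "K4 *\<^sub>v quat_vec q = quat_vec (qcnj q)"
  by (cases q; rule eq_vecI)
    (auto simp: less_4 K4_def mat_diag_def scalar_prod_def sum_4 quat_vec_def qcnj_def)

text \<open>
  Left and right multiplication by a unit quaternion are orthogonal maps, and their inverses are the
  multiplications by its conjugate; conjugating a quaternion therefore transposes both matrices.
\<close>

lemma phi_qcnj: "phi (qcnj q) = (phi q)\<^sup>T"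
  by (cases q; rule eq_matI) (auto simp: less_4 phi_def qcnj_def mat_of_four_rows)

lemma tau_qcnj: "tau (qcnj q) = (tau q)\<^sup>T"
  by (cases q; rule eq_matI) (auto simp: less_4 tau_def qcnj_def mat_of_four_rows)

text \<open>
  The relation \<open>p * qcnj x = qcnj (x * qcnj p)\<close>, read as an identity of matrices. It is what makes the
  off-diagonal blocks of \<open>omega a\<close> swap correctly under transposition.
\<close>

lemma phi_K4: "phi q * K4 = K4 * tau (qcnj q)"
  by (cases q; rule eq_matI)
    (auto simp: less_4 phi_def tau_def K4_def qcnj_def mat_diag_def mat_of_four_rows
      scalar_prod_def sum_4)

lemma K4_transpose: "K4\<^sup>T = K4"
  by (rule eq_matI) (auto simp: K4_def mat_diag_def)


section \<open>Octonion multiplication and conjugation in coordinates\<close>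

definition oct_vec :: "octonion \<Rightarrow> real vec" where
  "oct_vec a = quat_vec (oct_fst a) @\<^sub>v quat_vec (oct_snd a)"

lemma oct_vec_carrier [simp]: "oct_vec a \<in> carrier_vec 8"
  using append_carrier_vec[of "quat_vec (oct_fst a)" 4 "quat_vec (oct_snd a)" 4]
  by (simp add: oct_vec_def)

lemma dim_oct_vec [simp]: "dim_vec (oct_vec a) = 8"
  by (rule carrier_vecD) simp

lemma omega_carrier [simp]: "omega a \<in> carrier_mat 8 8"
  using four_block_carrier_mat[of "phi (oct_fst a)" 4 4 "tau (oct_fst a)" 4 4]
  by (simp add: omega_def)

lemma oct_vec_index_zero: "k < 8 \<Longrightarrow> oct_vec 0 $ k = 0"
  by (simp add: oct_vec_def zero_octonion_def quat_vec_0)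

lemma oct_vec_index_add: "k < 8 \<Longrightarrow> oct_vec (a + b) $ k = oct_vec a $ k + oct_vec b $ k"
  by (simp add: oct_vec_def plus_octonion_def quat_vec_add)
    (simp add: quat_vec_def)

lemma oct_vec_index_scaleR: "k < 8 \<Longrightarrow> oct_vec (c *\<^sub>R a) $ k = c * oct_vec a $ k"
  by (simp add: oct_vec_def scaleR_octonion_def quat_vec_scaleR)
    (simp add: quat_vec_def)

lemma oct_vec_index_sum: "k < 8 \<Longrightarrow> oct_vec (\<Sum>s\<in>S. f s) $ k = (\<Sum>s\<in>S. oct_vec (f s) $ k)"
  by (induction S rule: infinite_finite_induct)
    (simp_all add: oct_vec_index_zero oct_vec_index_add)

lemma octonion_eqI:
  assumes "\<And>k. k < 8 \<Longrightarrow> oct_vec a $ k = oct_vec b $ k"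
  shows "a = b"
proof -
  have "oct_vec a = oct_vec b"
    using assms by (intro eq_vecI) simp_all
  then have "quat_vec (oct_fst a) = quat_vec (oct_fst b) \<and> quat_vec (oct_snd a) = quat_vec (oct_snd b)"
    unfolding oct_vec_def by (subst (asm) append_vec_eq[of _ 4]) auto
  then show ?thesis
    by (auto simp: octonion_eq_iff dest: quat_vec_inject)
qed

text \<open>
  An octonion product is linear in its right factor, and in coordinates the four summands of the
  Cayley-Dickson product are the four blocks of \<open>omega\<close>. Since octonions do not associate,
  \<open>omega\<close> is not multiplicative; only its action on vectors is available, and it suffices.
\<close>

lemma omega_left_mult: "omega a *\<^sub>v oct_vec b = oct_vec (a * b)"
proof -
  let ?a1 = "oct_fst a" and ?a2 = "oct_snd a" and ?b1 = "oct_fst b" and ?b2 = "oct_snd b"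
  have upper: "- (tau ?a2 * K4) *\<^sub>v quat_vec ?b2 = quat_vec (- (qcnj ?b2 * ?a2))"
    by (subst uminus_mult_mat_vec)
      (simp_all add: assoc_mult_mat_vec[of _ 4 4 _ 4] K4_qcnj tau_right_mult quat_vec_uminus
        carrier_vecD[OF quat_vec_carrier] carrier_matD[OF K4_carrier])
  have lower: "(phi ?a2 * K4) *\<^sub>v quat_vec ?b1 = quat_vec (?a2 * qcnj ?b1)"
    by (simp add: assoc_mult_mat_vec[of _ 4 4 _ 4] K4_qcnj phi_left_mult)
  have "omega a *\<^sub>v oct_vec b
      = (phi ?a1 *\<^sub>v quat_vec ?b1 + - (tau ?a2 * K4) *\<^sub>v quat_vec ?b2)
          @\<^sub>v ((phi ?a2 * K4) *\<^sub>v quat_vec ?b1 + tau ?a1 *\<^sub>v quat_vec ?b2)"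
    unfolding omega_def oct_vec_def
    by (rule four_block_mat_mult_vec[of _ 4 4 _ 4 _ 4]) auto
  also have "\<dots> = quat_vec (?a1 * ?b1 + - (qcnj ?b2 * ?a2)) @\<^sub>v quat_vec (?a2 * qcnj ?b1 + ?b2 * ?a1)"
    by (simp only: upper lower phi_left_mult tau_right_mult quat_vec_add)
  also have "\<dots> = oct_vec (a * b)"
    by (simp add: oct_vec_def times_octonion_def add.commute)
  finally show ?thesis .
qed

definition ocnj :: "octonion \<Rightarrow> octonion" where
  "ocnj a = Oct (qcnj (oct_fst a)) (- oct_snd a)"

lemma qcnj_mult: "qcnj (p * q) = qcnj q * qcnj p"
  by (simp add: qcnj_def times_quat_def algebra_simps)

lemma qcnj_qcnj: "qcnj (qcnj q) = q"
  by (simp add: qcnj_def)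

lemma qcnj_add: "qcnj (p + q) = qcnj p + qcnj q"
  by (simp add: qcnj_def plus_quat_def)

lemma qcnj_uminus: "qcnj (- q) = - qcnj q"
  by (simp add: qcnj_def uminus_quat_def)

lemma qcnj_diff: "qcnj (p - q) = qcnj p - qcnj q"
  by (simp add: qcnj_def minus_quat_def)

lemma ocnj_mult: "ocnj (a * b) = ocnj b * ocnj a"
  by (simp add: ocnj_def times_octonion_def qcnj_mult qcnj_qcnj qcnj_diff qcnj_uminus)

lemma ocnj_ocnj: "ocnj (ocnj a) = a"
  by (simp add: ocnj_def qcnj_qcnj)

lemma ocnj_0: "ocnj 0 = 0"
  by (simp add: ocnj_def zero_octonion_def qcnj_def zero_quat_def uminus_quat_def)

lemma ocnj_1: "ocnj 1 = 1"
  by (simp add: ocnj_def one_octonion_def qcnj_def one_quat_def zero_quat_def uminus_quat_def)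

lemma ocnj_add: "ocnj (a + b) = ocnj a + ocnj b"
  by (simp add: ocnj_def plus_octonion_def qcnj_add)

lemma ocnj_scaleR: "ocnj (c *\<^sub>R a) = c *\<^sub>R ocnj a"
  by (simp add: ocnj_def scaleR_octonion_def qcnj_def scaleR_quat_def uminus_quat_def)

lemma ocnj_sum: "ocnj (\<Sum>s\<in>S. f s) = (\<Sum>s\<in>S. ocnj (f s))"
  by (induction S rule: infinite_finite_induct) (simp_all add: ocnj_0 ocnj_add)

lemma phi_uminus: "phi (- q) = - phi q"
  by (cases q; rule eq_matI) (auto simp: less_4 phi_def mat_of_four_rows uminus_quat_def)

lemma tau_uminus: "tau (- q) = - tau q"
  by (cases q; rule eq_matI) (auto simp: less_4 tau_def mat_of_four_rows uminus_quat_def)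

text \<open>
  This is the reason why right powers have the same annihilating polynomial as left powers: passing
  to conjugates only transposes the real representation, which preserves characteristic polynomials.
\<close>

lemma omega_ocnj: "omega (ocnj a) = (omega a)\<^sup>T"
proof -
  let ?p = "oct_fst a" and ?q = "oct_snd a"
  have "(omega a)\<^sup>T = four_block_mat ((phi ?p)\<^sup>T) ((phi ?q * K4)\<^sup>T) ((- (tau ?q * K4))\<^sup>T) ((tau ?p)\<^sup>T)"
    unfolding omega_def by (rule transpose_four_block_mat[of _ 4 4 _ 4 _ 4]) auto
  moreover have "(phi ?q * K4)\<^sup>T = - (tau (- ?q) * K4)"
  proof -
    have "(phi ?q * K4)\<^sup>T = (K4 * tau (qcnj ?q))\<^sup>T"
      by (simp only: phi_K4)
    also have "\<dots> = tau ?q * K4"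
      by (subst transpose_mult[of _ 4 4 _ 4]) (simp_all add: K4_transpose tau_qcnj)
    finally show ?thesis
      by (simp add: tau_uminus carrier_matD[OF K4_carrier] carrier_matD[OF tau_carrier])
  qed
  moreover have "(- (tau ?q * K4))\<^sup>T = phi (- ?q) * K4"
  proof -
    have "(tau ?q * K4)\<^sup>T = K4 * tau (qcnj ?q)"
      by (subst transpose_mult[of _ 4 4 _ 4]) (simp_all add: K4_transpose tau_qcnj)
    also have "\<dots> = phi ?q * K4"
      by (simp only: phi_K4)
    finally show ?thesis
      by (simp add: phi_uminus transpose_uminus carrier_matD[OF K4_carrier] carrier_matD[OF phi_carrier])
  qed
  ultimately show ?thesis
    by (simp add: omega_def ocnj_def phi_qcnj tau_qcnj)
qed

lemma octonion_mult_1_right: "a * 1 = (a :: octonion)"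
  by (simp add: octonion_eq_iff times_octonion_def one_octonion_def qcnj_def zero_quat_def
      one_quat_def times_quat_def quat_eq_iff plus_quat_def minus_quat_def)

lemma octonion_mult_0_right: "a * 0 = (0 :: octonion)"
  by (simp add: octonion_eq_iff times_octonion_def zero_octonion_def qcnj_def zero_quat_def
      times_quat_def quat_eq_iff plus_quat_def minus_quat_def)

section \<open>The Cayley-Hamilton recurrence\<close>

text \<open>
  The Cayley-Hamilton theorem in the form needed here: only the orbit of a vector under \<open>M\<close> is
  involved, so no powers of \<open>M\<close> have to be formed. Let \<open>B\<close> be the adjugate of \<open>x I - M\<close>, a
  matrix of polynomials, and \<open>B\<^sub>s\<close> its matrix of coefficients at \<open>x^s\<close>. Comparing coefficients in
  \<open>B (x I - M) = p I\<close> gives \<open>p\<^sub>s I = B\<^sub>r - B\<^sub>s M\<close> with \<open>r = s - 1\<close> (and \<open>B\<^sub>r = 0\<close> for \<open>s = 0\<close>).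
  Applied to \<open>u s\<close>, the right-hand side becomes a difference of consecutive terms, because
  \<open>M *\<^sub>v u s\<close> is \<open>u (Suc s)\<close>, and the sum telescopes to zero.
\<close>

lemma char_poly_recurrence:
  fixes M :: "'a :: comm_ring_1 mat" and u :: "nat \<Rightarrow> 'a vec"
  assumes M: "M \<in> carrier_mat n n"
    and u: "\<And>s. u s \<in> carrier_vec n"
    and step: "\<And>s. u (Suc s) = M *\<^sub>v u s"
    and i: "i < n"
  shows "(\<Sum>s\<le>degree (char_poly M). coeff (char_poly M) s * u s $ i) = 0"
proof -
  let ?p = "char_poly M"
  define C where "C = char_poly_matrix M"
  define B where "B = adj_mat C"
  \<comment> \<open>\<open>c s\<close> is entry \<open>i\<close> of the previous coefficient of \<open>B\<close> applied to \<open>u s\<close>; the factor \<open>x\<close> in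
    \<open>pCons 0\<close> shifts the index and makes \<open>c 0\<close> vanish.\<close>
  define c where "c s = (\<Sum>j<n. coeff (pCons 0 (B $$ (i, j))) s * u s $ j)" for s
  have C: "C \<in> carrier_mat n n"
    using M by (simp add: C_def)
  have B: "B \<in> carrier_mat n n" and BC: "B * C = ?p \<cdot>\<^sub>m 1\<^sub>m n"
    using adj_mat[OF C] by (simp_all add: B_def C_def char_poly_def)
  have dims: "dim_row M = n" "dim_col M = n" "dim_row B = n" "dim_col B = n" "dim_row C = n" "dim_col C = n"
    using M B C by auto
  have adj: "(if i = j then ?p else 0)
      = pCons 0 (B $$ (i, j)) - (\<Sum>k<n. Polynomial.smult (M $$ (k, j)) (B $$ (i, k)))" if j: "j < n" for j
  proof -
    have "(if i = j then ?p else 0) = (B * C) $$ (i, j)"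
      using i j by (simp add: BC)
    also have "\<dots> = (\<Sum>k<n. B $$ (i, k) * C $$ (k, j))"
      using i j dims by (simp add: scalar_prod_def lessThan_atLeast0)
    also have "\<dots> = (\<Sum>k<n. (if k = j then pCons 0 (B $$ (i, j)) else 0)
        - Polynomial.smult (M $$ (k, j)) (B $$ (i, k)))"
      using j dims by (intro sum.cong) (auto simp: C_def char_poly_matrix_def)
    also have "\<dots> = pCons 0 (B $$ (i, j)) - (\<Sum>k<n. Polynomial.smult (M $$ (k, j)) (B $$ (i, k)))"
      using j by (simp add: sum_subtractf)
    finally show ?thesis .
  qed
  have telescope: "coeff ?p s * u s $ i = c s - c (Suc s)" for s
  proof -
    have "coeff ?p s * u s $ i = (\<Sum>j<n. coeff (if i = j then ?p else 0) s * u s $ j)"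
      using i by (simp add: if_distrib[of "\<lambda>q. coeff q s"] if_distrib[of "\<lambda>x. x * _"] cong: if_cong)
    also have "\<dots> = (\<Sum>j<n. coeff (pCons 0 (B $$ (i, j))) s * u s $ j
        - (\<Sum>k<n. coeff (B $$ (i, k)) s * (M $$ (k, j) * u s $ j)))"
      by (intro sum.cong refl)
        (simp add: adj coeff_sum left_diff_distrib sum_distrib_right mult.assoc mult.left_commute)
    also have "\<dots> = c s - (\<Sum>j<n. \<Sum>k<n. coeff (B $$ (i, k)) s * (M $$ (k, j) * u s $ j))"
      by (simp add: sum_subtractf c_def)
    also have "(\<Sum>j<n. \<Sum>k<n. coeff (B $$ (i, k)) s * (M $$ (k, j) * u s $ j))
        = (\<Sum>k<n. coeff (B $$ (i, k)) s * (\<Sum>j<n. M $$ (k, j) * u s $ j))"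
      by (subst sum.swap) (simp add: sum_distrib_left)
    also have "\<dots> = c (Suc s)"
      unfolding c_def using dims carrier_vecD[OF u[of s]]
      by (intro sum.cong) (simp_all add: step scalar_prod_def lessThan_atLeast0)
    finally show ?thesis .
  qed
  \<comment> \<open>Any bound above the degree of \<open>p\<close> and of every polynomial in row \<open>i\<close> of \<open>x B\<close> would do.\<close>
  define N where "N = Suc (degree ?p + (\<Sum>j<n. degree (pCons 0 (B $$ (i, j)))))"
  have "c N = 0"
  proof -
    have "degree (pCons 0 (B $$ (i, j))) < N" if "j < n" for j
      using member_le_sum[of j "{..<n}" "\<lambda>j. degree (pCons 0 (B $$ (i, j)))"] that
      by (simp add: N_def less_Suc_eq_le)
    then show ?thesis
      unfolding c_def by (intro sum.neutral ballI) (simp add: coeff_eq_0)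
  qed
  have "(\<Sum>s\<le>degree ?p. coeff ?p s * u s $ i) = (\<Sum>s<N. coeff ?p s * u s $ i)"
    by (rule sum.mono_neutral_left) (auto simp: N_def coeff_eq_0)
  also have "\<dots> = c 0 - c N"
    by (simp only: telescope sum_lessThan_telescope')
  also have "\<dots> = 0"
    using \<open>c N = 0\<close> by (simp add: c_def)
  finally show ?thesis .
qed


section \<open>Left powers of an octonion matrix\<close>

text \<open>
  The indexing is that of the 8 by 8 blocks of \<open>omega_mat\<close>, so that block \<open>(s, t)\<close> of \<open>omega_mat A\<close>
  acts on the coordinates of the entry of \<open>X\<close> in row \<open>t\<close>.
\<close>

definition oct_col :: "octonion mat \<Rightarrow> nat \<Rightarrow> real vec" where
  "oct_col X j = vec (8 * dim_row X) (\<lambda>i. oct_vec (X $$ (i div 8, j)) $ (i mod 8))"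

lemma sum_blocks_8:
  fixes f :: "nat \<Rightarrow> nat \<Rightarrow> 'a :: comm_monoid_add"
  shows "(\<Sum>l<8 * n. f (l div 8) (l mod 8)) = (\<Sum>k<n. \<Sum>l<8. f k l)"
proof -
  have "(\<Sum>l<8 * n. f (l div 8) (l mod 8)) = (\<Sum>k<n. \<Sum>l = k * 8..<k * 8 + 8. f (l div 8) (l mod 8))"
    by (simp add: sum.nat_group mult.commute)
  also have "\<dots> = (\<Sum>k<n. \<Sum>l<8. f k l)"
  proof (rule sum.cong[OF refl])
    fix k
    have "(\<Sum>l = k * 8..<k * 8 + 8. f (l div 8) (l mod 8))
        = (\<Sum>l = 0..<8. f ((l + k * 8) div 8) ((l + k * 8) mod 8))"
      using sum.shift_bounds_nat_ivl[of "\<lambda>l. f (l div 8) (l mod 8)" 0 "k * 8" 8]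
      by (simp add: add.commute)
    then show "(\<Sum>l = k * 8..<k * 8 + 8. f (l div 8) (l mod 8)) = (\<Sum>l<8. f k l)"
      by (simp add: lessThan_atLeast0)
  qed
  finally show ?thesis .
qed

lemma omega_mat_carrier: "A \<in> carrier_mat m n \<Longrightarrow> omega_mat A \<in> carrier_mat (8 * m) (8 * n)"
  by (simp add: omega_mat_def)

lemma oct_mat_mult_carrier:
  "A \<in> carrier_mat m n \<Longrightarrow> X \<in> carrier_mat n p \<Longrightarrow> A *\<^sub>O X \<in> carrier_mat m p"
  by (simp add: oct_mat_mult_def)

text \<open>
  Each column of a product \<open>A *\<^sub>O X\<close> involves only single products of an entry of \<open>A\<close> with an entry
  of \<open>X\<close>, so the bracketing never matters and the entrywise statement \<open>omega_left_mult\<close> extends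
  blockwise.
\<close>

lemma omega_mat_mult_col:
  assumes A: "A \<in> carrier_mat m n" and X: "X \<in> carrier_mat n p" and j: "j < p"
  shows "omega_mat A *\<^sub>v oct_col X j = oct_col (A *\<^sub>O X) j"
proof (rule eq_vecI)
  have dims: "dim_row A = m" "dim_col A = n" "dim_row X = n" "dim_col X = p"
    using A X by auto
  show "dim_vec (omega_mat A *\<^sub>v oct_col X j) = dim_vec (oct_col (A *\<^sub>O X) j)"
    using dims by (simp add: omega_mat_def oct_col_def oct_mat_mult_def)
  fix i
  assume "i < dim_vec (oct_col (A *\<^sub>O X) j)"
  then have i: "i < 8 * m" "i div 8 < m"
    using dims by (auto simp: oct_col_def oct_mat_mult_def)
  let ?w = "\<lambda>k. omega (A $$ (i div 8, k))"
  have "(omega_mat A *\<^sub>v oct_col X j) $ i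
      = (\<Sum>l<8 * n. ?w (l div 8) $$ (i mod 8, l mod 8) * oct_vec (X $$ (l div 8, j)) $ (l mod 8))"
    using i dims by (simp add: omega_mat_def oct_col_def scalar_prod_def lessThan_atLeast0)
  also have "\<dots> = (\<Sum>k<n. \<Sum>l<8. ?w k $$ (i mod 8, l) * oct_vec (X $$ (k, j)) $ l)"
    by (rule sum_blocks_8)
  also have "\<dots> = (\<Sum>k<n. oct_vec (A $$ (i div 8, k) * X $$ (k, j)) $ (i mod 8))"
  proof (intro sum.cong refl)
    fix k
    have "(\<Sum>l<8. ?w k $$ (i mod 8, l) * oct_vec (X $$ (k, j)) $ l)
        = (?w k *\<^sub>v oct_vec (X $$ (k, j))) $ (i mod 8)"
      using carrier_matD[OF omega_carrier]
      by (simp add: scalar_prod_def lessThan_atLeast0)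
    then show "(\<Sum>l<8. ?w k $$ (i mod 8, l) * oct_vec (X $$ (k, j)) $ l)
        = oct_vec (A $$ (i div 8, k) * X $$ (k, j)) $ (i mod 8)"
      by (simp add: omega_left_mult)
  qed
  also have "\<dots> = oct_col (A *\<^sub>O X) j $ i"
    using i j dims by (simp add: oct_col_def oct_mat_mult_def oct_vec_index_sum)
  finally show "(omega_mat A *\<^sub>v oct_col X j) $ i = oct_col (A *\<^sub>O X) j $ i" .
qed

lemma oct_mat_mult_one:
  assumes "A \<in> carrier_mat m n"
  shows "A *\<^sub>O 1\<^sub>m n = A"
proof (rule eq_matI)
  fix i j
  assume ij: "i < dim_row A" "j < dim_col A"
  have "(\<Sum>k<n. A $$ (i, k) * (1\<^sub>m n $$ (k, j))) = (\<Sum>k<n. if k = j then A $$ (i, j) else 0)"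
    using ij assms by (intro sum.cong) (auto simp: octonion_mult_1_right octonion_mult_0_right)
  also have "\<dots> = A $$ (i, j)"
    using ij assms by simp
  finally show "(A *\<^sub>O 1\<^sub>m n) $$ (i, j) = A $$ (i, j)"
    using ij assms by (simp add: oct_mat_mult_def)
qed (use assms in \<open>simp_all add: oct_mat_mult_def\<close>)

lemma oct_mat_lpow_Suc:
  assumes "A \<in> carrier_mat m m"
  shows "oct_mat_lpow A (Suc s) = A *\<^sub>O oct_mat_lpow A s"
  using assms by (cases s) (simp_all add: oct_mat_mult_one)

lemma oct_mat_lpow_carrier:
  "A \<in> carrier_mat m m \<Longrightarrow> oct_mat_lpow A s \<in> carrier_mat m m"
  by (induction s) (auto simp: oct_mat_lpow_Suc intro: oct_mat_mult_carrier)

text \<open>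
  Column \<open>b\<close> of the left powers \<open>A (A (\<cdots> (A I)))\<close> runs through an orbit of \<open>omega_mat A\<close>, starting
  from column \<open>b\<close> of the identity matrix. The recurrence of the characteristic polynomial therefore
  holds for each real coordinate of each entry.
\<close>

lemma oct_mat_lpow_cayley_hamilton:
  assumes A: "A \<in> carrier_mat m m" and a: "a < m" and b: "b < m"
  defines "p \<equiv> char_poly (omega_mat A)"
  shows "(\<Sum>s\<le>degree p. coeff p s *\<^sub>R oct_mat_lpow A s $$ (a, b)) = 0"
proof (rule octonion_eqI)
  fix k :: nat
  assume k: "k < 8"
  have L: "oct_mat_lpow A s \<in> carrier_mat m m" for s
    using A by (rule oct_mat_lpow_carrier)
  let ?u = "\<lambda>s. oct_col (oct_mat_lpow A s) b"
  have entry: "?u s $ (8 * a + k) = oct_vec (oct_mat_lpow A s $$ (a, b)) $ k" for s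
    using a k carrier_matD(1)[OF L[of s]] by (simp add: oct_col_def)
  have "(\<Sum>s\<le>degree p. coeff p s * ?u s $ (8 * a + k)) = 0"
    unfolding p_def
  proof (rule char_poly_recurrence)
    show "omega_mat A \<in> carrier_mat (8 * m) (8 * m)"
      using A by (rule omega_mat_carrier)
    show "?u s \<in> carrier_vec (8 * m)" for s
      using carrier_matD(1)[OF L[of s]] by (simp add: oct_col_def)
    show "?u (Suc s) = omega_mat A *\<^sub>v ?u s" for s
      by (simp only: oct_mat_lpow_Suc[OF A] omega_mat_mult_col[OF A L b])
    show "8 * a + k < 8 * m"
      using a k by simp
  qed
  then show "oct_vec (\<Sum>s\<le>degree p. coeff p s *\<^sub>R oct_mat_lpow A s $$ (a, b)) $ k = oct_vec 0 $ k"
    using k by (simp add: entry oct_vec_index_sum oct_vec_index_scaleR oct_vec_index_zero)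
qed


section \<open>Right powers by conjugate transposition\<close>

definition oct_adjoint :: "octonion mat \<Rightarrow> octonion mat" where
  "oct_adjoint X = mat (dim_col X) (dim_row X) (\<lambda>(i, j). ocnj (X $$ (j, i)))"

lemma oct_adjoint_carrier: "X \<in> carrier_mat m n \<Longrightarrow> oct_adjoint X \<in> carrier_mat n m"
  by (simp add: oct_adjoint_def)

lemma oct_adjoint_mult:
  assumes "A \<in> carrier_mat m n" "B \<in> carrier_mat n p"
  shows "oct_adjoint (A *\<^sub>O B) = oct_adjoint B *\<^sub>O oct_adjoint A"
  using assms
  by (intro eq_matI) (auto simp: oct_adjoint_def oct_mat_mult_def ocnj_sum ocnj_mult)

lemma omega_mat_adjoint: "omega_mat (oct_adjoint A) = (omega_mat A)\<^sup>T"
  by (rule eq_matI)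
    (auto simp: omega_mat_def oct_adjoint_def omega_ocnj carrier_matD[OF omega_carrier])

text \<open>
  Conjugate transposition reverses products, hence turns the left-nested brackets of a right power
  into the right-nested brackets of a left power.
\<close>

lemma oct_adjoint_rpow:
  assumes A: "A \<in> carrier_mat m m"
  shows "oct_mat_rpow A s \<in> carrier_mat m m
    \<and> oct_adjoint (oct_mat_rpow A s) = oct_mat_lpow (oct_adjoint A) s"
  using A
proof (induction A s rule: oct_mat_rpow.induct)
  case (1 A)
  then show ?case
    by (auto simp: oct_adjoint_def ocnj_0 ocnj_1)
next
  case (2 A)
  then show ?case
    by simp
next
  case (3 A s)
  then show ?case
    by (auto simp: oct_adjoint_mult[of _ m m _ m] intro: oct_mat_mult_carrier)
qed

text \<open>
  Apply the identity for left powers to the conjugate transpose of \<open>A\<close>, whose real representation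
  is the transpose of \<open>omega_mat A\<close>, and conjugate the result; the coefficients are real and are
  left fixed.
\<close>

lemma oct_mat_rpow_cayley_hamilton:
  assumes A: "A \<in> carrier_mat m m" and a: "a < m" and b: "b < m"
  defines "p \<equiv> char_poly (omega_mat A)"
  shows "(\<Sum>s\<le>degree p. coeff p s *\<^sub>R oct_mat_rpow A s $$ (a, b)) = 0"
proof -
  have p: "p = char_poly (omega_mat (oct_adjoint A))"
    by (simp add: p_def omega_mat_adjoint char_poly_transpose_mat[OF omega_mat_carrier[OF A]])
  have entry: "oct_mat_lpow (oct_adjoint A) s $$ (b, a) = ocnj (oct_mat_rpow A s $$ (a, b))" for s
    using oct_adjoint_rpow[OF A, of s, THEN conjunct1] a b
    by (simp add: oct_adjoint_rpow[OF A, THEN conjunct2, symmetric])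
      (auto simp: oct_adjoint_def)
  have "ocnj (\<Sum>s\<le>degree p. coeff p s *\<^sub>R oct_mat_rpow A s $$ (a, b)) = 0"
    using oct_mat_lpow_cayley_hamilton[OF oct_adjoint_carrier[OF A] b a]
    by (simp add: p[symmetric] entry ocnj_sum ocnj_scaleR)
  then show ?thesis
    by (metis ocnj_ocnj ocnj_0)
qed


section \<open>The two identities\<close>

text \<open>
  In the sum over all \<open>s \<le> t\<close> the constant and the leading term are split off. They are distinct terms
  only for \<open>0 < t\<close>.
\<close>

lemma matrix_identity_from_entries:
  fixes P :: "nat \<Rightarrow> octonion mat" and c r :: "nat \<Rightarrow> real"
  assumes P: "\<And>s. P s \<in> carrier_mat m m" and P0: "P 0 = 1\<^sub>m m" and "0 < t"
    and c: "c t = 1" "\<And>s. s < t \<Longrightarrow> c s = r s"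
    and zero: "\<And>a b. a < m \<Longrightarrow> b < m \<Longrightarrow> (\<Sum>s\<le>t. c s *\<^sub>R P s $$ (a, b)) = 0"
  shows "P t + oct_mat_sum m m (\<lambda>s. r s \<cdot>\<^sub>O P s) {1..<t} + r 0 \<cdot>\<^sub>O 1\<^sub>m m = 0\<^sub>m m m"
proof (rule eq_matI)
  fix a b
  assume "a < dim_row (0\<^sub>m m m :: octonion mat)" "b < dim_col (0\<^sub>m m m :: octonion mat)"
  then have ab: "a < m" "b < m"
    by simp_all
  have split: "{..t} = insert t (insert 0 {1..<t})"
    using \<open>0 < t\<close> by auto
  have "0 = P t $$ (a, b) + (r 0 *\<^sub>R P 0 $$ (a, b) + (\<Sum>s = 1..<t. r s *\<^sub>R P s $$ (a, b)))"
    using zero[OF ab] \<open>0 < t\<close> c by (simp add: split)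
  then show "(P t + oct_mat_sum m m (\<lambda>s. r s \<cdot>\<^sub>O P s) {1..<t} + r 0 \<cdot>\<^sub>O 1\<^sub>m m) $$ (a, b)
      = 0\<^sub>m m m $$ (a, b)"
    using ab carrier_matD[OF P] P0 by (simp add: oct_mat_sum_def oct_mat_scaleR_def ac_simps)
qed (use carrier_matD[OF P] in \<open>simp_all add: oct_mat_sum_def oct_mat_scaleR_def\<close>)

theorem theorem4p16:
  fixes A :: "octonion mat" and m t :: nat and r :: "nat \<Rightarrow> real"
  assumes "0 < m"
    and "A \<in> carrier_mat m m"
    and "char_poly (omega_mat A) = monom 1 t + (\<Sum>s<t. monom (r s) s)"
  shows "oct_mat_lpow A t + oct_mat_sum m m (\<lambda>s. r s \<cdot>\<^sub>O oct_mat_lpow A s) {1..<t}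
           + r 0 \<cdot>\<^sub>O 1\<^sub>m m = 0\<^sub>m m m
       \<and> oct_mat_rpow A t + oct_mat_sum m m (\<lambda>s. r s \<cdot>\<^sub>O oct_mat_rpow A s) {1..<t}
           + r 0 \<cdot>\<^sub>O 1\<^sub>m m = 0\<^sub>m m m"
proof -
  let ?p = "char_poly (omega_mat A)"
  have coeff_p: "coeff ?p k = (if k = t then 1 else 0) + (if k < t then r k else 0)" for k
    unfolding assms(3) by (auto simp: coeff_sum)
  have deg: "degree ?p = t"
  proof (rule antisym)
    show "degree ?p \<le> t"
      by (rule degree_le) (simp add: coeff_p)
    show "t \<le> degree ?p"
      by (rule le_degree) (simp add: coeff_p)
  qed
  \<comment> \<open>The degree is \<open>8 * m\<close>.\<close>
  have t: "0 < t"
    using degree_monic_char_poly[OF omega_mat_carrier[OF assms(2)]] deg assms(1) by simp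
  note A = assms(2)
  show ?thesis
  proof
    show "oct_mat_lpow A t + oct_mat_sum m m (\<lambda>s. r s \<cdot>\<^sub>O oct_mat_lpow A s) {1..<t}
        + r 0 \<cdot>\<^sub>O 1\<^sub>m m = 0\<^sub>m m m"
      using A t oct_mat_lpow_cayley_hamilton[OF A, unfolded deg]
      by (intro matrix_identity_from_entries[where c = "coeff ?p"])
        (auto simp: oct_mat_lpow_carrier coeff_p)
    show "oct_mat_rpow A t + oct_mat_sum m m (\<lambda>s. r s \<cdot>\<^sub>O oct_mat_rpow A s) {1..<t}
        + r 0 \<cdot>\<^sub>O 1\<^sub>m m = 0\<^sub>m m m"
      using A t oct_mat_rpow_cayley_hamilton[OF A, unfolded deg] oct_adjoint_rpow[OF A]
      by (intro matrix_identity_from_entries[where c = "coeff ?p"])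
        (auto simp: coeff_p)
  qed
qed

end
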